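(* Let $(\gamma,\nu):I\to\Delta_1$ be a spacelike Legendre curve with curvature $(m,n)$ such that $\{t\in I:n(t)\ne0\}$ is dense in $I$, and let $P^\pm(\gamma,\lambda_\pm)$ be a horocyclic parallel of $\gamma$. Suppose that there exists a smooth function $f:I\to\mathbb R$ such that $m(t)+f(t)n(t)=0$ for all $t\in I$. Then the horocyclic evolute of $P^\pm(\gamma,\lambda_\pm)$ exists. Denote the horocyclic evolute of $(P^\pm(\gamma,\lambda_\pm),\nu_P^\pm)$ (respectively, $(P^\pm(\gamma,\lambda_\pm),-\nu_P^\pm)$) by $Ev^\pm(P^\pm(\gamma,\lambda_\pm))$ (respectively, $\overline{Ev}^\pm(P^\pm(\gamma,\lambda_\pm))$), where the superscript on $Ev$ or $\overline{Ev}$ may be chosen independently of the one on $P$. Then for all $t\in I$: (1) $Ev^+(P^+(\gamma,\lambda_+))(t)=Ev^+(\gamma)(t)$ and $Ev^-(P^-(\gamma,\lambda_-))(t)=Ev^-(\gamma)(t)$. (2) $\overline{Ev}^+(P^-(\gamma,\lambda_-))(t)=Ev^-(\gamma)(t)$ and $\overline{Ev}^-(P^+(\gamma,\lambda_+))(t)=Ev^+(\gamma)(t)$.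
   Context: All maps are $C^\infty$; $I\subset\mathbb R$ is an interval; a dot denotes $d/dt$. In every formula with $\pm,\mp$ the upper signs are taken together and the lower signs together unless said otherwise. $\mathbb R^3_1$ is $\mathbb R^3$ with $\langle x,y\rangle=-x_1y_1+x_2y_2+x_3y_3$ and $x\wedge y=(-(x_2y_3-x_3y_2),\,x_3y_1-x_1y_3,\,x_1y_2-x_2y_1)$. $H^2=\{x:\langle x,x\rangle=-1,\ x_1>0\}$, $S^2_1=\{x:\langle x,x\rangle=1\}$, $\Delta_1=\{(\nu_1,\nu_2)\in H^2\times S_1^2:\langle\nu_1,\nu_2\rangle=0\}$. A spacelike Legendre curve is a map $(\gamma,\nu):I\to\Delta_1$ with $\langle\dot\gamma,\nu\rangle=0$ on $I$; put $\mu=\gamma\wedge\nu$. Its curvature is the pair $(m,n)$ with $\dot\gamma=m\mu$, $\dot\nu=n\mu$ (then $\dot\mu=m\gamma-n\nu$). $(\gamma,-\nu)$ is then a spacelike Legendre curve with curvature $(-m,n)$ and third frame vector $-\mu$. Horocyclic evolute: for any spacelike Legendre curve $(\gamma,\nu)$ with curvature $(m,n)$, it exists if there is a smooth $f:I\to\mathbb R$ with $m+fn=0$ on $I$, and then $Ev^\pm(\gamma)=\gamma+f\nu+\frac{f^2}{2}(\gamma\pm\mu)$. ($f$ is unique when $\{n\neq0\}$ is dense in $I$.) Horocyclic parallel: $P^\pm(\gamma,\lambda_\pm)=\gamma+\lambda_\pm\nu+\frac{\lambda_\pm^2}{2}(\gamma\pm\mu)$, where $\lambda_\pm:I\to\mathbb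 R$ is a solution of $\dot\lambda_\pm=\mp(\frac{\lambda_\pm^2n}{2}+\lambda_\pm m)$. $(P^\pm(\gamma,\lambda_\pm),\nu_P^\pm)$ with $\nu_P^\pm=\lambda_\pm\gamma+\nu\pm\lambda_\pm\mu$ is a spacelike Legendre curve. *)

theory Defs
  imports "HOL-Analysis.Analysis"
begin

text \<open>Lorentz-Minkowski 3-space: the first coordinate is the timelike one.\<close>

definition mink :: "real^3 \<Rightarrow> real^3 \<Rightarrow> real" where
  "mink x y = - (x$1 * y$1) + x$2 * y$2 + x$3 * y$3"

definition mwedge :: "real^3 \<Rightarrow> real^3 \<Rightarrow> real^3" where
  "mwedge x y = vector [- (x$2 * y$3 - x$3 * y$2), x$3 * y$1 - x$1 * y$3, x$1 * y$2 - x$2 * y$1]"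

definition hyperbolic_plane :: "(real^3) set" where
  "hyperbolic_plane = {x. mink x x = -1 \<and> x$1 > 0}"

definition de_sitter :: "(real^3) set" where
  "de_sitter = {x. mink x x = 1}"

definition Delta1 :: "((real^3) \<times> (real^3)) set" where
  "Delta1 = {(v, w). v \<in> hyperbolic_plane \<and> w \<in> de_sitter \<and> mink v w = 0}"

text \<open>Maps on an interval \<open>I\<close> are total functions on the reals of which only the values on \<open>I\<close>
  matter; derivatives are taken within \<open>I\<close>, hence are one-sided at end points belonging to \<open>I\<close>.
  They are unique when \<open>I\<close> is not a single point.
  In the next definition \<open>D k\<close> is the \<open>k\<close>-th derivative.\<close>

definition smooth_on :: "real set \<Rightarrow> (real \<Rightarrow> 'a::real_normed_vector) \<Rightarrow> bool" where
  "smooth_on I f \<longleftrightarrow> (\<exists>D :: nat \<Rightarrow> real \<Rightarrow> 'a.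
     (\<forall>t\<in>I. D 0 t = f t) \<and>
     (\<forall>k. \<forall>t\<in>I. (D k has_vector_derivative D (Suc k) t) (at t within I)))"

definition spacelike_legendre :: "real set \<Rightarrow> (real \<Rightarrow> real^3) \<Rightarrow> (real \<Rightarrow> real^3) \<Rightarrow> bool" where
  "spacelike_legendre I \<gamma> \<nu> \<longleftrightarrow>
     smooth_on I \<gamma> \<and> smooth_on I \<nu> \<and>
     (\<forall>t\<in>I. (\<gamma> t, \<nu> t) \<in> Delta1) \<and>
     (\<forall>t\<in>I. mink (vector_derivative \<gamma> (at t within I)) (\<nu> t) = 0)"

definition frame_mu :: "(real \<Rightarrow> real^3) \<Rightarrow> (real \<Rightarrow> real^3) \<Rightarrow> real \<Rightarrow> real^3" where
  "frame_mu \<gamma> \<nu> t = mwedge (\<gamma> t) (\<nu> t)"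

definition has_curvature ::
  "real set \<Rightarrow> (real \<Rightarrow> real^3) \<Rightarrow> (real \<Rightarrow> real^3) \<Rightarrow> (real \<Rightarrow> real) \<Rightarrow> (real \<Rightarrow> real) \<Rightarrow> bool" where
  "has_curvature I \<gamma> \<nu> m n \<longleftrightarrow>
     smooth_on I m \<and> smooth_on I n \<and>
     (\<forall>t\<in>I. (\<gamma> has_vector_derivative m t *\<^sub>R frame_mu \<gamma> \<nu> t) (at t within I)) \<and>
     (\<forall>t\<in>I. (\<nu> has_vector_derivative n t *\<^sub>R frame_mu \<gamma> \<nu> t) (at t within I))"

text \<open>The smooth functions \<open>f\<close> with \<open>m + f n = 0\<close> from which the horocyclic evolute of \<open>(\<gamma>, \<nu>)\<close>
  is formed; the horocyclic evolute exists if there is one.\<close>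

definition evolute_function ::
  "real set \<Rightarrow> (real \<Rightarrow> real^3) \<Rightarrow> (real \<Rightarrow> real^3) \<Rightarrow> (real \<Rightarrow> real) \<Rightarrow> bool" where
  "evolute_function I \<gamma> \<nu> f \<longleftrightarrow>
     spacelike_legendre I \<gamma> \<nu> \<and> smooth_on I f \<and>
     (\<exists>m n. has_curvature I \<gamma> \<nu> m n \<and> (\<forall>t\<in>I. m t + f t * n t = 0))"

definition horocyclic_evolute_exists ::
  "real set \<Rightarrow> (real \<Rightarrow> real^3) \<Rightarrow> (real \<Rightarrow> real^3) \<Rightarrow> bool" where
  "horocyclic_evolute_exists I \<gamma> \<nu> \<longleftrightarrow> (\<exists>f. evolute_function I \<gamma> \<nu> f)"

text \<open>From here on \<open>\<sigma>\<close> encodes the sign choice: \<open>\<sigma> = 1\<close> stands for the upper signs and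
  \<open>\<sigma> = -1\<close> for the lower ones; no other value is meant.\<close>

definition Ev :: "real \<Rightarrow> (real \<Rightarrow> real^3) \<Rightarrow> (real \<Rightarrow> real^3) \<Rightarrow> (real \<Rightarrow> real) \<Rightarrow> real \<Rightarrow> real^3" where
  "Ev \<sigma> \<gamma> \<nu> f t =
     \<gamma> t + f t *\<^sub>R \<nu> t + ((f t)\<^sup>2 / 2) *\<^sub>R (\<gamma> t + \<sigma> *\<^sub>R frame_mu \<gamma> \<nu> t)"

definition parallel_function ::
  "real \<Rightarrow> real set \<Rightarrow> (real \<Rightarrow> real) \<Rightarrow> (real \<Rightarrow> real) \<Rightarrow> (real \<Rightarrow> real) \<Rightarrow> bool" where
  "parallel_function \<sigma> I m n l \<longleftrightarrow>
     smooth_on I l \<and>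
     (\<forall>t\<in>I. (l has_vector_derivative - \<sigma> * ((l t)\<^sup>2 * n t / 2 + l t * m t)) (at t within I))"

definition horo_parallel ::
  "real \<Rightarrow> (real \<Rightarrow> real^3) \<Rightarrow> (real \<Rightarrow> real^3) \<Rightarrow> (real \<Rightarrow> real) \<Rightarrow> real \<Rightarrow> real^3" where
  "horo_parallel \<sigma> \<gamma> \<nu> l t =
     \<gamma> t + l t *\<^sub>R \<nu> t + ((l t)\<^sup>2 / 2) *\<^sub>R (\<gamma> t + \<sigma> *\<^sub>R frame_mu \<gamma> \<nu> t)"

definition parallel_normal ::
  "real \<Rightarrow> (real \<Rightarrow> real^3) \<Rightarrow> (real \<Rightarrow> real^3) \<Rightarrow> (real \<Rightarrow> real) \<Rightarrow> real \<Rightarrow> real^3" where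
  "parallel_normal \<sigma> \<gamma> \<nu> l t =
     l t *\<^sub>R \<gamma> t + \<nu> t + (\<sigma> * l t) *\<^sub>R frame_mu \<gamma> \<nu> t"

end

theory Submission
  imports Defs
begin

text \<open>Along the parallel, \<open>P + \<sigma> \<mu>\<^sub>P = \<gamma> + \<sigma> \<mu>\<close>: the lightlike direction of the evolute formula
  is the same for \<open>\<gamma>\<close> and for \<open>P\<close>, and \<open>\<nu>\<^sub>P = \<nu> + \<lambda> (\<gamma> + \<sigma> \<mu>)\<close>. Since \<open>P\<close> has curvature
  \<open>(m + \<lambda> n, n)\<close>, its evolute function is \<open>f - \<lambda>\<close>, and the evolute of \<open>P\<close> is the composition of
  two translations along the same horocycles, by \<open>\<lambda>\<close> and by \<open>f - \<lambda>\<close>. Reversing the normal turns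
  \<open>(\<mu>, f)\<close> into \<open>(-\<mu>, -f)\<close>, which is absorbed by the sign \<open>\<sigma>\<close> in the evolute formula.\<close>

section \<open>Closure properties of smooth maps on a subset of the line\<close>

lemma smooth_on_add:
  assumes "smooth_on I f" "smooth_on I g"
  shows "smooth_on I (\<lambda>t. f t + g t)"
proof -
  from assms obtain D E where
    "\<forall>t\<in>I. D 0 t = f t" "\<forall>k. \<forall>t\<in>I. (D k has_vector_derivative D (Suc k) t) (at t within I)"
    "\<forall>t\<in>I. E 0 t = g t" "\<forall>k. \<forall>t\<in>I. (E k has_vector_derivative E (Suc k) t) (at t within I)"
    unfolding smooth_on_def by blast
  then show ?thesis
    unfolding smooth_on_def
    by (intro exI[of _ "\<lambda>k t. D k t + E k t"]) (auto intro: has_vector_derivative_add)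
qed

lemma smooth_on_const: "smooth_on I (\<lambda>t. c)"
  unfolding smooth_on_def
  by (rule exI[of _ "\<lambda>k t. if k = 0 then c else 0"]) auto

text \<open>\<open>leibniz pr D E k i j\<close> is the \<open>k\<close>-th derivative of \<open>pr (D i) (E j)\<close>.\<close>

primrec leibniz where
  "leibniz pr D E 0 i j t = pr (D i t) (E j t)"
| "leibniz pr D E (Suc k) i j t = leibniz pr D E k (Suc i) j t + leibniz pr D E k i (Suc j) t"

text \<open>Both indices \<open>i\<close> and \<open>j\<close> stay arbitrary because each
  differentiation raises one of them. The recursion is the product rule itself, so no binomial
  coefficients appear.\<close>

lemma leibniz_has_vector_derivative:
  fixes D :: "nat \<Rightarrow> real \<Rightarrow> 'a::real_normed_vector"
    and E :: "nat \<Rightarrow> real \<Rightarrow> 'b::real_normed_vector"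
    and pr :: "'a \<Rightarrow> 'b \<Rightarrow> 'c::real_normed_vector"
  assumes "bounded_bilinear pr"
    and "\<And>k. (D k has_vector_derivative D (Suc k) t) (at t within I)"
    and "\<And>k. (E k has_vector_derivative E (Suc k) t) (at t within I)"
  shows "(leibniz pr D E k i j has_vector_derivative leibniz pr D E (Suc k) i j t) (at t within I)"
proof (induction k arbitrary: i j)
  case 0
  show ?case
    using bounded_bilinear.has_vector_derivative[OF assms(1) assms(2)[of i] assms(3)[of j]]
    by (simp add: add.commute)
next
  case (Suc k)
  show ?case
    using has_vector_derivative_add[OF Suc[of "Suc i" j] Suc[of i "Suc j"]] by simp
qed

lemma smooth_on_bilinear:
  assumes "bounded_bilinear pr" "smooth_on I f" "smooth_on I g"
  shows "smooth_on I (\<lambda>t. pr (f t) (g t))"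
proof -
  from assms(2,3) obtain D E where
    "\<forall>t\<in>I. D 0 t = f t" "\<forall>k. \<forall>t\<in>I. (D k has_vector_derivative D (Suc k) t) (at t within I)"
    "\<forall>t\<in>I. E 0 t = g t" "\<forall>k. \<forall>t\<in>I. (E k has_vector_derivative E (Suc k) t) (at t within I)"
    unfolding smooth_on_def by blast
  then show ?thesis
    unfolding smooth_on_def
    by (intro exI[of _ "\<lambda>k. leibniz pr D E k 0 0"])
      (use leibniz_has_vector_derivative[OF assms(1)] in auto)
qed

lemmas smooth_on_scaleR = smooth_on_bilinear[OF bounded_bilinear_scaleR]
lemmas smooth_on_mult = smooth_on_bilinear[OF bounded_bilinear_mult]

lemma smooth_on_uminus: "smooth_on I f \<Longrightarrow> smooth_on I (\<lambda>t. - f t)"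
  using smooth_on_scaleR[OF smooth_on_const[of I "-1"]] by fastforce

lemma smooth_on_diff:
  "smooth_on I f \<Longrightarrow> smooth_on I g \<Longrightarrow> smooth_on I (\<lambda>t. f t - g t)"
  using smooth_on_add[of I f "\<lambda>t. - g t"] smooth_on_uminus[of I g] by simp

lemma smooth_on_imp_continuous_on:
  assumes "smooth_on I f"
  shows "continuous_on I f"
proof -
  from assms obtain D where D: "\<forall>t\<in>I. D 0 t = f t"
    "\<forall>t\<in>I. (D 0 has_vector_derivative D (Suc 0) t) (at t within I)"
    unfolding smooth_on_def by blast
  from D(2) have "continuous_on I (D 0)"
    by (intro continuous_on_vector_derivative) auto
  then show ?thesis
    by (rule continuous_on_eq) (use D(1) in auto)
qed

section \<open>Algebra of the Lorentzian product and wedge\<close>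

lemma mwedge_nth [simp]:
  "mwedge x y $ 1 = - (x$2 * y$3 - x$3 * y$2)"
  "mwedge x y $ 2 = x$3 * y$1 - x$1 * y$3"
  "mwedge x y $ 3 = x$1 * y$2 - x$2 * y$1"
  by (simp_all add: mwedge_def)

lemma bilinear_mwedge: "bilinear mwedge"
  by (auto simp: bilinear_def linear_iff vec_eq_iff forall_3 algebra_simps)

lemma bounded_bilinear_mwedge: "bounded_bilinear mwedge"
  using bilinear_mwedge bilinear_conv_bounded_bilinear by blast

lemmas mwedge_bilinear_simps =
  bounded_bilinear.add_left[OF bounded_bilinear_mwedge]
  bounded_bilinear.add_right[OF bounded_bilinear_mwedge]
  bounded_bilinear.scaleR_left[OF bounded_bilinear_mwedge]
  bounded_bilinear.scaleR_right[OF bounded_bilinear_mwedge]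

lemma mwedge_self: "mwedge x x = 0"
  by (simp add: vec_eq_iff forall_3)

lemma mwedge_anticommute: "mwedge y x = - mwedge x y"
  by (simp add: vec_eq_iff forall_3)

text \<open>Lorentzian form of the double cross product formula, with the sign opposite to the
  Euclidean one. It yields the wedge table of the frame \<open>\<gamma>\<close>,
  \<open>\<nu>\<close>, \<open>\<mu>\<close>.\<close>

lemma mwedge_triple: "mwedge x (mwedge y z) = mink x y *\<^sub>R z - mink x z *\<^sub>R y"
  by (simp add: vec_eq_iff forall_3 mink_def algebra_simps)

lemma mink_commute: "mink y x = mink x y"
  by (simp add: mink_def)

lemma mink_bilinear_simps:
  "mink (x + y) z = mink x z + mink y z" "mink z (x + y) = mink z x + mink z y"
  "mink (c *\<^sub>R x) z = c * mink x z" "mink z (c *\<^sub>R x) = c * mink z x"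
  "mink (- x) z = - mink x z" "mink z (- x) = - mink z x"
  by (simp_all add: mink_def algebra_simps)

lemma mink_mwedge_self: "mink x (mwedge x y) = 0" "mink y (mwedge x y) = 0"
  by (simp_all add: mink_def algebra_simps)

text \<open>Lagrange identity, again with the opposite sign; hence the wedge of a pair in
  \<open>Delta1\<close> is a unit spacelike vector.\<close>

lemma mink_mwedge_mwedge:
  "mink (mwedge x y) (mwedge x y) = (mink x y)\<^sup>2 - mink x x * mink y y"
  by (simp add: mink_def power2_eq_square algebra_simps)

text \<open>If \<open>y$1\<close> were nonpositive, \<open>- (x$1 * y$1)\<close> would be
  nonnegative and, by Cauchy-Schwarz in the spatial coordinates, would dominate their product, so
  \<open>mink x y\<close> could not be negative.\<close>

lemma unit_timelike_same_sheet:
  assumes x: "x \<in> hyperbolic_plane" and y: "mink y y = -1" and neg: "mink x y < 0"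
  shows "y \<in> hyperbolic_plane"
proof (rule ccontr)
  assume "y \<notin> hyperbolic_plane"
  with y have y1: "y$1 \<le> 0" by (auto simp: hyperbolic_plane_def)
  have xx: "(x$2)\<^sup>2 + (x$3)\<^sup>2 \<le> (x$1)\<^sup>2" and x1: "x$1 > 0"
    using x by (auto simp: hyperbolic_plane_def mink_def power2_eq_square)
  have yy: "(y$2)\<^sup>2 + (y$3)\<^sup>2 \<le> (y$1)\<^sup>2"
    using y by (auto simp: mink_def power2_eq_square)
  have "(x$2 * y$2 + x$3 * y$3)\<^sup>2 \<le> ((x$2)\<^sup>2 + (x$3)\<^sup>2) * ((y$2)\<^sup>2 + (y$3)\<^sup>2)"
    \<comment> \<open>This square is exactly the defect in the planar Cauchy-Schwarz
      inequality.\<close>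
    using zero_le_power2[of "x$2 * y$3 - x$3 * y$2"]
    by (simp add: power2_eq_square algebra_simps)
  also have "\<dots> \<le> (x$1)\<^sup>2 * (y$1)\<^sup>2"
    by (intro mult_mono xx yy) auto
  also have "\<dots> = (- (x$1 * y$1))\<^sup>2"
    by (simp add: power_mult_distrib)
  finally have "\<bar>x$2 * y$2 + x$3 * y$3\<bar> \<le> \<bar>- (x$1 * y$1)\<bar>"
    by (simp only: abs_le_square_iff)
  moreover have "x$1 * y$1 \<le> 0"
    using x1 y1 by (simp add: mult_nonneg_nonpos)
  ultimately show False
    using neg by (auto simp: mink_def)
qed

lemma Delta1_mink:
  assumes "(x, y) \<in> Delta1"
  shows "mink x x = -1" "mink y y = 1" "mink x y = 0" "mink y x = 0"
  using assms by (auto simp: Delta1_def hyperbolic_plane_def de_sitter_def mink_commute)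

lemma Delta1_mwedge_frame:
  assumes "(x, y) \<in> Delta1"
  shows "mwedge x (mwedge x y) = - y" "mwedge (mwedge x y) x = y"
    "mwedge y (mwedge x y) = - x" "mwedge (mwedge x y) y = x"
  using Delta1_mink[OF assms] mwedge_anticommute[of x "mwedge x y"]
    mwedge_anticommute[of y "mwedge x y"]
  by (simp_all add: mwedge_triple)

lemma Delta1_mink_frame:
  assumes "(x, y) \<in> Delta1"
  shows "mink x (mwedge x y) = 0" "mink (mwedge x y) x = 0"
    "mink y (mwedge x y) = 0" "mink (mwedge x y) y = 0"
    "mink (mwedge x y) (mwedge x y) = 1"
  using Delta1_mink[OF assms] mink_mwedge_self(1)[of x y] mink_mwedge_self(2)[of y x]
    mink_commute[of "mwedge x y" x] mink_commute[of "mwedge x y" y]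
  by (simp_all add: mink_mwedge_mwedge)

section \<open>The lightlike direction and the frame of the parallel\<close>

text \<open>For \<open>s = 1\<close> or \<open>s = -1\<close> this null vector \<open>k\<close>
  fixes the ideal point of a horocycle: the points \<open>\<gamma> + c \<nu> + (c^2/2) k\<close> all
  satisfy \<open>mink x k = -1\<close>. Parallels and evolutes are both of this form.\<close>

definition lightlike_dir :: "real \<Rightarrow> (real \<Rightarrow> real^3) \<Rightarrow> (real \<Rightarrow> real^3) \<Rightarrow> real \<Rightarrow> real^3" where
  "lightlike_dir s \<gamma> \<nu> t = \<gamma> t + s *\<^sub>R frame_mu \<gamma> \<nu> t"

lemma horo_parallel_eq:
  "horo_parallel s \<gamma> \<nu> l t = \<gamma> t + l t *\<^sub>R \<nu> t + ((l t)\<^sup>2 / 2) *\<^sub>R lightlike_dir s \<gamma> \<nu> t"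
  by (simp add: horo_parallel_def lightlike_dir_def)

lemma parallel_normal_eq:
  "parallel_normal s \<gamma> \<nu> l t = \<nu> t + l t *\<^sub>R lightlike_dir s \<gamma> \<nu> t"
  by (simp add: parallel_normal_def lightlike_dir_def scaleR_add_right mult.commute)

lemma mink_lightlike_dir:
  assumes "s\<^sup>2 = 1" "(\<gamma> t, \<nu> t) \<in> Delta1"
  defines "k \<equiv> lightlike_dir s \<gamma> \<nu> t"
  shows "mink k k = 0" "mink (\<gamma> t) k = -1" "mink k (\<gamma> t) = -1"
    "mink (\<nu> t) k = 0" "mink k (\<nu> t) = 0"
  using assms(1) Delta1_mink[OF assms(2)] Delta1_mink_frame[OF assms(2)]
  by (simp_all add: k_def lightlike_dir_def frame_mu_def mink_bilinear_simps power2_eq_square)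

lemma mwedge_lightlike_dir:
  assumes "s\<^sup>2 = 1" "(\<gamma> t, \<nu> t) \<in> Delta1"
  defines "k \<equiv> lightlike_dir s \<gamma> \<nu> t"
  shows "mwedge (\<gamma> t) k = - s *\<^sub>R \<nu> t" "mwedge (\<nu> t) k = - s *\<^sub>R k" "mwedge k (\<nu> t) = s *\<^sub>R k"
  using assms(1) mwedge_anticommute[of "\<nu> t" "\<gamma> t"]
  by (simp_all add: k_def lightlike_dir_def frame_mu_def mwedge_bilinear_simps mwedge_self
      Delta1_mwedge_frame[OF assms(2)] scaleR_add_right power2_eq_square)

text \<open>Expand the wedge of \<open>\<gamma> + l \<nu> + (l^2/2) k\<close> and
  \<open>\<nu> + l k\<close>. The terms in \<open>k\<close> are \<open>- s l^2\<close> from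
  \<open>\<nu>\<close> with \<open>k\<close> and \<open>s l^2/2\<close> from \<open>k\<close> with
  \<open>\<nu>\<close>.\<close>

lemma frame_mu_parallel:
  assumes "s\<^sup>2 = 1" "(\<gamma> t, \<nu> t) \<in> Delta1"
  shows "frame_mu (horo_parallel s \<gamma> \<nu> l) (parallel_normal s \<gamma> \<nu> l) t =
    frame_mu \<gamma> \<nu> t - (s * l t) *\<^sub>R \<nu> t - (s * (l t)\<^sup>2 / 2) *\<^sub>R lightlike_dir s \<gamma> \<nu> t"
  unfolding frame_mu_def[of "horo_parallel s \<gamma> \<nu> l"] horo_parallel_eq parallel_normal_eq
    mwedge_bilinear_simps mwedge_lightlike_dir[of s \<gamma> t \<nu>, OF assms] mwedge_self
  by (simp add: frame_mu_def vec_eq_iff power2_eq_square field_simps del: mwedge_nth)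

text \<open>Multiplied by \<open>s\<close>, the correction to \<open>\<mu>\<close> is the negative
  of the correction to \<open>\<gamma>\<close>, since \<open>s^2 = 1\<close>; the two cancel in the
  sum.\<close>

lemma lightlike_dir_parallel:
  assumes "s\<^sup>2 = 1" "(\<gamma> t, \<nu> t) \<in> Delta1"
  shows "lightlike_dir s (horo_parallel s \<gamma> \<nu> l) (parallel_normal s \<gamma> \<nu> l) t =
    lightlike_dir s \<gamma> \<nu> t"
proof -
  have s: "s * (s * c) = c" for c
    using assms(1) by (metis mult.assoc mult_1 power2_eq_square)
  then show ?thesis
    unfolding lightlike_dir_def[of s "horo_parallel s \<gamma> \<nu> l"] horo_parallel_eq
      frame_mu_parallel[of s \<gamma> t \<nu>, OF assms]
    by (simp add: scaleR_diff_right s) (simp add: lightlike_dir_def)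
qed

lemma parallel_Delta1:
  assumes "s\<^sup>2 = 1" "(\<gamma> t, \<nu> t) \<in> Delta1"
  shows "(horo_parallel s \<gamma> \<nu> l t, parallel_normal s \<gamma> \<nu> l t) \<in> Delta1"
proof -
  let ?P = "horo_parallel s \<gamma> \<nu> l t" and ?N = "parallel_normal s \<gamma> \<nu> l t"
  note products = horo_parallel_eq parallel_normal_eq mink_bilinear_simps
    Delta1_mink[OF assms(2)] mink_lightlike_dir[of s \<gamma> t \<nu>, OF assms]
  have "mink ?P ?P = -1" "mink ?N ?N = 1" "mink ?P ?N = 0"
    by (simp_all add: products power2_eq_square)
  \<comment> \<open>The product with \<open>\<gamma>\<close> is negative, which places the parallel
    on the same sheet as \<open>\<gamma>\<close>.\<close>
  moreover have "mink (\<gamma> t) ?P = - 1 - (l t)\<^sup>2 / 2"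
    by (simp add: products)
  then have "mink (\<gamma> t) ?P < 0"
    using zero_le_power2[of "l t"] by linarith
  moreover have "\<gamma> t \<in> hyperbolic_plane"
    using assms(2) by (simp add: Delta1_def)
  ultimately show ?thesis
    using unit_timelike_same_sheet by (auto simp: Delta1_def de_sitter_def)
qed

section \<open>Derivatives of the frame and curvature of the parallel\<close>

lemma smooth_on_frame_mu:
  "smooth_on I \<gamma> \<Longrightarrow> smooth_on I \<nu> \<Longrightarrow> smooth_on I (frame_mu \<gamma> \<nu>)"
  unfolding frame_mu_def[abs_def] by (rule smooth_on_bilinear[OF bounded_bilinear_mwedge])

lemma frame_mu_has_vector_derivative:
  assumes "(\<gamma> t, \<nu> t) \<in> Delta1" "has_curvature I \<gamma> \<nu> m n" "t \<in> I"
  shows "(frame_mu \<gamma> \<nu> has_vector_derivative m t *\<^sub>R \<gamma> t - n t *\<^sub>R \<nu> t) (at t within I)"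
proof -
  have "((\<lambda>t. mwedge (\<gamma> t) (\<nu> t)) has_vector_derivative
      mwedge (\<gamma> t) (n t *\<^sub>R frame_mu \<gamma> \<nu> t) + mwedge (m t *\<^sub>R frame_mu \<gamma> \<nu> t) (\<nu> t)) (at t within I)"
    using assms by (intro bounded_bilinear.has_vector_derivative[OF bounded_bilinear_mwedge])
      (auto simp: has_curvature_def)
  then show ?thesis
    by (simp add: frame_mu_def[abs_def] mwedge_bilinear_simps Delta1_mwedge_frame[OF assms(1)])
qed

text \<open>The derivative is \<open>m \<mu> + s m \<gamma> - s n \<nu>\<close>. As
  \<open>s^2 = 1\<close>, its first two terms combine to \<open>s m k\<close>.\<close>

lemma lightlike_dir_has_vector_derivative:
  assumes "s\<^sup>2 = 1" "(\<gamma> t, \<nu> t) \<in> Delta1" "has_curvature I \<gamma> \<nu> m n" "t \<in> I"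
  shows "(lightlike_dir s \<gamma> \<nu> has_vector_derivative
    (s * m t) *\<^sub>R lightlike_dir s \<gamma> \<nu> t - (s * n t) *\<^sub>R \<nu> t) (at t within I)"
proof -
  have "((\<lambda>t. \<gamma> t + s *\<^sub>R frame_mu \<gamma> \<nu> t) has_vector_derivative
      m t *\<^sub>R frame_mu \<gamma> \<nu> t + s *\<^sub>R (m t *\<^sub>R \<gamma> t - n t *\<^sub>R \<nu> t)) (at t within I)"
    using assms
    by (intro has_vector_derivative_add frame_mu_has_vector_derivative
        bounded_linear.has_vector_derivative[OF bounded_linear_scaleR_right])
      (auto simp: has_curvature_def)
  moreover have s: "s * (s * m t) = m t"
    using assms(1) by (metis mult.assoc mult_1 power2_eq_square)
  ultimately show ?thesis
    by (simp add: lightlike_dir_def[abs_def] scaleR_add_right scaleR_diff_right algebra_simps s)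
qed

text \<open>The filter condition makes \<open>vector_derivative\<close> take the value given by the
  curvature, a multiple of \<open>\<mu>\<close> and so orthogonal to \<open>\<nu>\<close>.\<close>

lemma spacelike_legendreI:
  assumes "\<And>t. t \<in> I \<Longrightarrow> at t within I \<noteq> bot"
    and "smooth_on I \<gamma>" "smooth_on I \<nu>" and "\<And>t. t \<in> I \<Longrightarrow> (\<gamma> t, \<nu> t) \<in> Delta1"
    and "has_curvature I \<gamma> \<nu> m n"
  shows "spacelike_legendre I \<gamma> \<nu>"
proof -
  have "mink (vector_derivative \<gamma> (at t within I)) (\<nu> t) = 0" if "t \<in> I" for t
  proof -
    have "vector_derivative \<gamma> (at t within I) = m t *\<^sub>R frame_mu \<gamma> \<nu> t"
      using assms(1,5) that by (intro vector_derivative_within) (auto simp: has_curvature_def)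
    then show ?thesis
      using Delta1_mink_frame[OF assms(4)[OF that]] by (simp add: mink_bilinear_simps frame_mu_def)
  qed
  with assms show ?thesis by (simp add: spacelike_legendre_def)
qed

text \<open>The differential equation for \<open>l\<close> is what makes the derivatives of the
  parallel and of its normal multiples of the new \<open>\<mu>\<close>.\<close>

lemma horo_parallel_has_curvature:
  assumes "s\<^sup>2 = 1" "spacelike_legendre I \<gamma> \<nu>" "has_curvature I \<gamma> \<nu> m n"
    and "parallel_function s I m n l"
  shows "has_curvature I (horo_parallel s \<gamma> \<nu> l) (parallel_normal s \<gamma> \<nu> l)
    (\<lambda>t. m t + l t * n t) n"
proof -
  let ?P = "horo_parallel s \<gamma> \<nu> l" and ?N = "parallel_normal s \<gamma> \<nu> l"
  have "(?P has_vector_derivative (m t + l t * n t) *\<^sub>R frame_mu ?P ?N t) (at t within I) \<and>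
      (?N has_vector_derivative n t *\<^sub>R frame_mu ?P ?N t) (at t within I)" if "t \<in> I" for t
  proof -
    have D: "(\<gamma> t, \<nu> t) \<in> Delta1"
      using assms(2) that by (simp add: spacelike_legendre_def)
    have g: "(\<gamma> has_vector_derivative m t *\<^sub>R frame_mu \<gamma> \<nu> t) (at t within I)"
      and v: "(\<nu> has_vector_derivative n t *\<^sub>R frame_mu \<gamma> \<nu> t) (at t within I)"
      using assms(3) that by (auto simp: has_curvature_def)
    define l' where "l' = - s * ((l t)\<^sup>2 * n t / 2 + l t * m t)"
    have l: "(l has_real_derivative l') (at t within I)"
      using assms(4) that
      by (simp add: l'_def parallel_function_def has_real_derivative_iff_has_vector_derivative)
    have q: "((\<lambda>t. (l t)\<^sup>2 / 2) has_real_derivative l t * l') (at t within I)"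
      by (auto intro!: derivative_eq_intros l)
    define k where "k = lightlike_dir s \<gamma> \<nu>"
    have k: "(k has_vector_derivative (s * m t) *\<^sub>R k t - (s * n t) *\<^sub>R \<nu> t) (at t within I)"
      unfolding k_def by (rule lightlike_dir_has_vector_derivative[OF assms(1) D assms(3) that])
    have "(?P has_vector_derivative
        m t *\<^sub>R frame_mu \<gamma> \<nu> t + (l t *\<^sub>R n t *\<^sub>R frame_mu \<gamma> \<nu> t + l' *\<^sub>R \<nu> t) +
        (((l t)\<^sup>2 / 2) *\<^sub>R ((s * m t) *\<^sub>R k t - (s * n t) *\<^sub>R \<nu> t) + (l t * l') *\<^sub>R k t)) (at t within I)"
      unfolding horo_parallel_eq[abs_def] k_def[symmetric]
      by (intro has_vector_derivative_add has_vector_derivative_scaleR g v l q k)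
    \<comment> \<open>Compare coefficients of \<open>\<mu>\<close>, \<open>\<nu>\<close> and
      \<open>k\<close>. At \<open>\<nu>\<close> this asks for
      \<open>l' - s l^2 n/2 = - s l (m + l n)\<close>, which is the differential equation; at
      \<open>k\<close> it asks for \<open>s l^2 m/2 + l l' = - s (l^2/2) (m + l n)\<close>, a
      consequence of it.\<close>
    also have "m t *\<^sub>R frame_mu \<gamma> \<nu> t + (l t *\<^sub>R n t *\<^sub>R frame_mu \<gamma> \<nu> t + l' *\<^sub>R \<nu> t) +
        (((l t)\<^sup>2 / 2) *\<^sub>R ((s * m t) *\<^sub>R k t - (s * n t) *\<^sub>R \<nu> t) + (l t * l') *\<^sub>R k t) =
      (m t + l t * n t) *\<^sub>R frame_mu ?P ?N t"
      unfolding frame_mu_parallel[of s \<gamma> t \<nu>, OF assms(1) D] k_def[symmetric]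
      by (simp add: l'_def vec_eq_iff power2_eq_square field_simps)
    finally have P: "(?P has_vector_derivative (m t + l t * n t) *\<^sub>R frame_mu ?P ?N t) (at t within I)" .
    have "(?N has_vector_derivative n t *\<^sub>R frame_mu \<gamma> \<nu> t +
        (l t *\<^sub>R ((s * m t) *\<^sub>R k t - (s * n t) *\<^sub>R \<nu> t) + l' *\<^sub>R k t)) (at t within I)"
      unfolding parallel_normal_eq[abs_def] k_def[symmetric]
      by (intro has_vector_derivative_add has_vector_derivative_scaleR v l k)
    \<comment> \<open>Here only the coefficient of \<open>k\<close> uses the equation:
      \<open>s l m + l' = - s l^2 n/2\<close>.\<close>
    also have "n t *\<^sub>R frame_mu \<gamma> \<nu> t +
        (l t *\<^sub>R ((s * m t) *\<^sub>R k t - (s * n t) *\<^sub>R \<nu> t) + l' *\<^sub>R k t) = n t *\<^sub>R frame_mu ?P ?N t"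
      unfolding frame_mu_parallel[of s \<gamma> t \<nu>, OF assms(1) D] k_def[symmetric]
      by (simp add: l'_def vec_eq_iff power2_eq_square field_simps)
    finally have N: "(?N has_vector_derivative n t *\<^sub>R frame_mu ?P ?N t) (at t within I)" .
    from P N show ?thesis ..
  qed
  moreover have "smooth_on I (\<lambda>t. m t + l t * n t)" "smooth_on I n"
    using assms by (auto simp: has_curvature_def parallel_function_def
        intro!: smooth_on_add smooth_on_mult)
  ultimately show ?thesis
    by (simp add: has_curvature_def)
qed

lemma horo_parallel_spacelike_legendre:
  assumes "\<And>t. t \<in> I \<Longrightarrow> at t within I \<noteq> bot"
    and "s\<^sup>2 = 1" "spacelike_legendre I \<gamma> \<nu>" "has_curvature I \<gamma> \<nu> m n"
    and "parallel_function s I m n l"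
  shows "spacelike_legendre I (horo_parallel s \<gamma> \<nu> l) (parallel_normal s \<gamma> \<nu> l)"
proof (rule spacelike_legendreI[OF assms(1) _ _ _ horo_parallel_has_curvature[OF assms(2-)]])
  have sm: "smooth_on I \<gamma>" "smooth_on I \<nu>" "smooth_on I l"
    using assms by (auto simp: spacelike_legendre_def parallel_function_def)
  note intros = sm smooth_on_add smooth_on_scaleR smooth_on_mult smooth_on_const
    smooth_on_frame_mu
  \<comment> \<open>The factor \<open>l^2/2\<close> is written as a product, so that closure under
    multiplication applies.\<close>
  have "smooth_on I (\<lambda>t. \<gamma> t + l t *\<^sub>R \<nu> t
      + (l t * l t * (1/2)) *\<^sub>R (\<gamma> t + s *\<^sub>R frame_mu \<gamma> \<nu> t))"
    by (intro intros)
  then show "smooth_on I (horo_parallel s \<gamma> \<nu> l)"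
    by (simp add: horo_parallel_def[abs_def] power2_eq_square)
  show "smooth_on I (parallel_normal s \<gamma> \<nu> l)"
    unfolding parallel_normal_def[abs_def] by (intro intros)
  show "(horo_parallel s \<gamma> \<nu> l t, parallel_normal s \<gamma> \<nu> l t) \<in> Delta1" if "t \<in> I" for t
    using assms(2,3) that by (intro parallel_Delta1) (auto simp: spacelike_legendre_def)
qed

section \<open>Reversal of the normal\<close>

lemma frame_mu_uminus: "frame_mu \<gamma> (\<lambda>t. - \<nu> t) t = - frame_mu \<gamma> \<nu> t"
  by (simp add: frame_mu_def vec_eq_iff forall_3)

lemma spacelike_legendre_uminus:
  assumes "spacelike_legendre I \<gamma> \<nu>"
  shows "spacelike_legendre I \<gamma> (\<lambda>t. - \<nu> t)"
  using assms
  by (auto simp: spacelike_legendre_def Delta1_def de_sitter_def mink_bilinear_simps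
      intro: smooth_on_uminus)

lemma has_curvature_uminus:
  assumes "has_curvature I \<gamma> \<nu> m n"
  shows "has_curvature I \<gamma> (\<lambda>t. - \<nu> t) (\<lambda>t. - m t) n"
  using assms
  by (auto simp: has_curvature_def frame_mu_uminus
      intro: smooth_on_uminus has_vector_derivative_minus)

lemma evolute_functionI:
  assumes "spacelike_legendre I \<gamma> \<nu>" "has_curvature I \<gamma> \<nu> m n"
    and "smooth_on I f" "\<And>t. t \<in> I \<Longrightarrow> m t + f t * n t = 0"
  shows "evolute_function I \<gamma> \<nu> f"
  using assms unfolding evolute_function_def by blast

text \<open>The signs cancel in pairs: in \<open>f \<nu>\<close>, in \<open>f^2\<close>, and in
  \<open>s \<mu>\<close>. This is why reversing the normal swaps the superscripts in the second
  claim.\<close>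

lemma Ev_uminus: "Ev (- s) \<gamma> (\<lambda>t. - \<nu> t) (\<lambda>t. - f t) t = Ev s \<gamma> \<nu> f t"
  by (simp add: Ev_def frame_mu_uminus)

section \<open>Uniqueness of the curvature and of the evolute function\<close>

text \<open>Derivatives within \<open>I\<close> are unique at a limit point, and
  \<open>\<mu>\<close> is nonzero because \<open>mink \<mu> \<mu> = 1\<close>, so the coefficients
  can be compared.\<close>

lemma curvature_unique:
  assumes "at t within I \<noteq> bot" "t \<in> I" "(\<gamma> t, \<nu> t) \<in> Delta1"
    and "has_curvature I \<gamma> \<nu> m n" "has_curvature I \<gamma> \<nu> m' n'"
  shows "m t = m' t" "n t = n' t"
proof -
  have "mink (frame_mu \<gamma> \<nu> t) (frame_mu \<gamma> \<nu> t) = 1"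
    using Delta1_mink_frame(5)[OF assms(3)] by (simp only: frame_mu_def)
  then have "frame_mu \<gamma> \<nu> t \<noteq> 0"
    by (auto simp: mink_def)
  moreover have "m t *\<^sub>R frame_mu \<gamma> \<nu> t = m' t *\<^sub>R frame_mu \<gamma> \<nu> t"
    by (rule vector_derivative_unique_within[OF assms(1), of \<gamma>])
      (use assms in \<open>auto simp: has_curvature_def\<close>)
  moreover have "n t *\<^sub>R frame_mu \<gamma> \<nu> t = n' t *\<^sub>R frame_mu \<gamma> \<nu> t"
    by (rule vector_derivative_unique_within[OF assms(1), of \<nu>])
      (use assms in \<open>auto simp: has_curvature_def\<close>)
  ultimately show "m t = m' t" "n t = n' t" by simp_all
qed

text \<open>Where \<open>n\<close> does not vanish, the value is forced to be
  \<open>- m / n\<close>; continuity carries the equality from this dense set to all of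
  \<open>I\<close>.\<close>

lemma evolute_function_unique:
  assumes nt: "\<And>t. t \<in> I \<Longrightarrow> at t within I \<noteq> bot"
    and curv: "has_curvature I \<gamma> \<nu> m n" and dense: "I \<subseteq> closure {t \<in> I. n t \<noteq> 0}"
    and f: "evolute_function I \<gamma> \<nu> f" and g: "evolute_function I \<gamma> \<nu> g" and t: "t \<in> I"
  shows "f t = g t"
proof -
  \<comment> \<open>\<open>evolute_function\<close> hides its curvature pair behind an existential;
    uniqueness of the curvature allows \<open>m\<close> and \<open>n\<close> in its place.\<close>
  have eq: "m r + h r * n r = 0" if h: "evolute_function I \<gamma> \<nu> h" and r: "r \<in> I" for h r
  proof -
    from h obtain m' n' where "has_curvature I \<gamma> \<nu> m' n'" "m' r + h r * n' r = 0"
      using r unfolding evolute_function_def by blast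
    moreover have "(\<gamma> r, \<nu> r) \<in> Delta1"
      using h r by (simp add: evolute_function_def spacelike_legendre_def)
    ultimately show ?thesis
      using curvature_unique[OF nt[OF r] r _ curv] by metis
  qed
  have zero: "f r - g r = 0" if "r \<in> I" "n r \<noteq> 0" for r
  proof -
    have "f r * n r = g r * n r"
      using eq[OF f that(1)] eq[OF g that(1)] by linarith
    with that show ?thesis by simp
  qed
  have cont: "continuous_on I (\<lambda>r. f r - g r)"
    using f g by (intro smooth_on_imp_continuous_on smooth_on_diff)
      (auto simp: evolute_function_def)
  from dense t have "t \<in> closure {t \<in> I. n t \<noteq> 0}"
    by blast
  then obtain x where x: "\<And>k. x k \<in> {t \<in> I. n t \<noteq> 0}" "x \<longlonglongrightarrow> t"
    unfolding closure_sequential by blast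
  have "(\<lambda>k. f (x k) - g (x k)) \<longlonglongrightarrow> f t - g t"
    using continuous_on_tendsto_compose[OF cont x(2) t] x(1) by auto
  with zero x(1) have "(\<lambda>k. 0) \<longlonglongrightarrow> f t - g t"
    by simp
  then show ?thesis
    by (simp add: LIMSEQ_const_iff)
qed

section \<open>Evolutes of the parallel\<close>

lemma Ev_eq:
  "Ev s \<gamma> \<nu> f t = \<gamma> t + f t *\<^sub>R \<nu> t + ((f t)\<^sup>2 / 2) *\<^sub>R lightlike_dir s \<gamma> \<nu> t"
  by (simp add: Ev_def lightlike_dir_def)

text \<open>The parameters add up to \<open>l + (f - l) = f\<close>, and the coefficients of
  \<open>k\<close> to \<open>l^2/2 + (f - l) l + (f - l)^2/2 = f^2/2\<close>.\<close>

lemma Ev_parallel: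
  assumes "s\<^sup>2 = 1" "(\<gamma> t, \<nu> t) \<in> Delta1"
  shows "Ev s (horo_parallel s \<gamma> \<nu> l) (parallel_normal s \<gamma> \<nu> l) (\<lambda>t. f t - l t) t = Ev s \<gamma> \<nu> f t"
  unfolding Ev_eq lightlike_dir_parallel[of s \<gamma> t \<nu>, OF assms]
  by (simp add: horo_parallel_eq parallel_normal_eq vec_eq_iff power2_eq_square field_simps)

lemma Ev_cong: "f t = g t \<Longrightarrow> Ev s \<gamma> \<nu> f t = Ev s \<gamma> \<nu> g t"
  by (simp add: Ev_def)

text \<open>Both sign choices are treated at once. The explicit functions \<open>f - l\<close> and
  \<open>- (f - l)\<close> give existence; by uniqueness any evolute function \<open>g\<close>
  agrees with the respective one on \<open>I\<close>.\<close>

lemma evolutes_of_parallel: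
  assumes nt: "\<And>t. t \<in> I \<Longrightarrow> at t within I \<noteq> bot"
    and s: "s\<^sup>2 = 1" and leg: "spacelike_legendre I \<gamma> \<nu>" and curv: "has_curvature I \<gamma> \<nu> m n"
    and dense: "I \<subseteq> closure {t \<in> I. n t \<noteq> 0}" and par: "parallel_function s I m n l"
    and f: "smooth_on I f" "\<And>t. t \<in> I \<Longrightarrow> m t + f t * n t = 0"
  defines "P \<equiv> horo_parallel s \<gamma> \<nu> l" and "N \<equiv> parallel_normal s \<gamma> \<nu> l"
  shows "horocyclic_evolute_exists I P N" "horocyclic_evolute_exists I P (\<lambda>t. - N t)"
    and "evolute_function I P N g \<Longrightarrow> t \<in> I \<Longrightarrow> Ev s P N g t = Ev s \<gamma> \<nu> f t"
    and "evolute_function I P (\<lambda>t. - N t) g \<Longrightarrow> t \<in> I \<Longrightarrow>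
      Ev (- s) P (\<lambda>t. - N t) g t = Ev s \<gamma> \<nu> f t"
proof -
  have legP: "spacelike_legendre I P N"
    unfolding P_def N_def using nt s leg curv par by (rule horo_parallel_spacelike_legendre)
  have curvP: "has_curvature I P N (\<lambda>t. m t + l t * n t) n"
    unfolding P_def N_def using s leg curv par by (rule horo_parallel_has_curvature)
  have sm: "smooth_on I (\<lambda>t. f t - l t)"
    using f par by (auto simp: parallel_function_def intro: smooth_on_diff)
  have ev: "evolute_function I P N (\<lambda>t. f t - l t)"
    by (rule evolute_functionI[OF legP curvP sm]) (use f(2) in \<open>simp add: algebra_simps\<close>)
  have "- (m t + l t * n t) + - (f t - l t) * n t = 0" if "t \<in> I" for t
    using f(2)[OF that] by (simp add: algebra_simps)
  then have ev': "evolute_function I P (\<lambda>t. - N t) (\<lambda>t. - (f t - l t))"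
    by (rule evolute_functionI[OF spacelike_legendre_uminus[OF legP]
          has_curvature_uminus[OF curvP] smooth_on_uminus[OF sm]])
  show "horocyclic_evolute_exists I P N" "horocyclic_evolute_exists I P (\<lambda>t. - N t)"
    using ev ev' unfolding horocyclic_evolute_exists_def by blast+
  have Ev: "Ev s P N (\<lambda>t. f t - l t) t = Ev s \<gamma> \<nu> f t" if "t \<in> I" for t
    unfolding P_def N_def using leg that s by (intro Ev_parallel) (auto simp: spacelike_legendre_def)
  show "Ev s P N g t = Ev s \<gamma> \<nu> f t" if "evolute_function I P N g" "t \<in> I"
  proof -
    have "g t = f t - l t"
      by (rule evolute_function_unique[OF nt curvP dense that(1) ev that(2)])
    then have "Ev s P N g t = Ev s P N (\<lambda>t. f t - l t) t"
      by (rule Ev_cong)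
    then show ?thesis
      by (simp only: Ev[OF that(2)])
  qed
  show "Ev (- s) P (\<lambda>t. - N t) g t = Ev s \<gamma> \<nu> f t"
    if "evolute_function I P (\<lambda>t. - N t) g" "t \<in> I"
  proof -
    have "g t = - (f t - l t)"
      by (rule evolute_function_unique[OF nt has_curvature_uminus[OF curvP] dense that(1) ev' that(2)])
    then have "Ev (- s) P (\<lambda>t. - N t) g t = Ev (- s) P (\<lambda>t. - N t) (\<lambda>t. - (f t - l t)) t"
      by (rule Ev_cong)
    then show ?thesis
      by (simp only: Ev_uminus Ev[OF that(2)])
  qed
qed

text \<open>A connected set with more than one point has no isolated points.\<close>

lemma interval_at_within_ne_bot:
  fixes I :: "real set"
  assumes "is_interval I" "interior I \<noteq> {}" "t \<in> I"
  shows "at t within I \<noteq> bot"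
proof -
  have "I \<noteq> {t}"
    using assms(2) by auto
  then have "t islimpt I"
    using assms(1,3) by (intro connected_imp_perfect) (auto simp: is_interval_connected)
  then show ?thesis
    by (simp add: trivial_limit_within)
qed

theorem proposition3p17:
  fixes I :: "real set" and \<gamma> \<nu> :: "real \<Rightarrow> real^3" and m n f lp lm :: "real \<Rightarrow> real"
  assumes "is_interval I" and "interior I \<noteq> {}"
    and "spacelike_legendre I \<gamma> \<nu>" and "has_curvature I \<gamma> \<nu> m n"
    and "I \<subseteq> closure {t \<in> I. n t \<noteq> 0}"
    and "parallel_function 1 I m n lp" and "parallel_function (-1) I m n lm"
    and "smooth_on I f" and "\<forall>t\<in>I. m t + f t * n t = 0"
  shows "let Pp = horo_parallel 1 \<gamma> \<nu> lp; \<nu>p = parallel_normal 1 \<gamma> \<nu> lp;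
             Pm = horo_parallel (-1) \<gamma> \<nu> lm; \<nu>m = parallel_normal (-1) \<gamma> \<nu> lm
    in horocyclic_evolute_exists I Pp \<nu>p \<and> horocyclic_evolute_exists I Pp (\<lambda>t. - \<nu>p t) \<and>
      horocyclic_evolute_exists I Pm \<nu>m \<and> horocyclic_evolute_exists I Pm (\<lambda>t. - \<nu>m t) \<and>
      (\<forall>g. evolute_function I Pp \<nu>p g \<longrightarrow> (\<forall>t\<in>I. Ev 1 Pp \<nu>p g t = Ev 1 \<gamma> \<nu> f t)) \<and>
      (\<forall>g. evolute_function I Pm \<nu>m g \<longrightarrow> (\<forall>t\<in>I. Ev (-1) Pm \<nu>m g t = Ev (-1) \<gamma> \<nu> f t)) \<and>
      (\<forall>g. evolute_function I Pm (\<lambda>t. - \<nu>m t) g \<longrightarrow>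
         (\<forall>t\<in>I. Ev 1 Pm (\<lambda>t. - \<nu>m t) g t = Ev (-1) \<gamma> \<nu> f t)) \<and>
      (\<forall>g. evolute_function I Pp (\<lambda>t. - \<nu>p t) g \<longrightarrow>
         (\<forall>t\<in>I. Ev (-1) Pp (\<lambda>t. - \<nu>p t) g t = Ev 1 \<gamma> \<nu> f t))"
proof -
  note nt = interval_at_within_ne_bot[OF assms(1,2)]
  \<comment> \<open>The parallel functions fix \<open>s\<close> as \<open>1\<close> and
    \<open>-1\<close>. Simplification discharges \<open>s^2 = 1\<close> and, in
    \<open>minus\<close>, turns \<open>- (-1)\<close> into \<open>1\<close>, the opposite
    superscript of the second claim.\<close>
  note plus = evolutes_of_parallel[OF nt _ assms(3-6,8) assms(9)[rule_format], simplified]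
  note minus = evolutes_of_parallel[OF nt _ assms(3-5,7,8) assms(9)[rule_format], simplified]
  show ?thesis
    unfolding Let_def using plus minus by blast
qed

end
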